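(* Let $K\subseteq[-1,1]^n$ be a measurable set with positive volume and suppose that $b(K)=(x_1,\dots,x_n)$. Then $$\mathrm{vol}(K)<e^n\prod_{i=1}^n\left(1-|x_i|\right).$$
   Context: $\mathrm{vol}$ is Lebesgue measure on $\mathbb{R}^n$ ($n\ge1$) and $b(K)=\frac{1}{\mathrm{vol}(K)}\int_Kx\,dx$ is the barycenter of $K$. *)

theory Defs
  imports "HOL-Analysis.Analysis"
begin

definition barycenter :: "(real ^ 'n) set \<Rightarrow> real ^ 'n" where
  "barycenter K = (1 / measure lebesgue K) *\<^sub>R (LINT y:K|lebesgue. y)"

end

theory Submission
  imports Defs
begin

text \<open>
  The estimate is a maximum entropy argument. Choose signs \<open>s i\<close> with \<open>s i * x $ i = \<bar>x $ i\<bar>\<close>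
  and put \<open>m i = 1 - \<bar>x $ i\<bar>\<close>; this is the mean of \<open>1 - s i * y $ i\<close> over \<open>K\<close>. Among
  all densities on a half-line whose distance to the end point has mean \<open>m i\<close>, the exponential one has
  the largest entropy, so \<open>K\<close> is tested against the product of these densities: let
  \<open>h y = - (\<Sum>i. (1 - s i * y $ i) / m i)\<close>. Its mean over \<open>K\<close> is \<open>-n\<close>, so Jensen's
  inequality for \<open>exp\<close> yields \<open>vol K * exp (-n) \<le> (\<integral>y\<in>K. exp (h y))\<close>.

  Enlarging \<open>K\<close> to the whole cube makes the right-hand side a product of one-dimensional
  integrals, with value \<open>\<Prod>i. m i * (1 - exp (-2 / m i))\<close>. The cube omits
  part of the half-line in each coordinate; this is why the inequality is strict.

  All of this needs \<open>m i > 0\<close>, that is, a barycenter in the open cube. This is where the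
  positivity of the volume enters: a nonnegative function with integral zero
  vanishes almost everywhere, while a facet of the cube is a null set.
\<close>

section \<open>Product integrals in Cartesian coordinates\<close>

lemma nn_integral_lborel_prod_cart:
  fixes f :: "'n::finite \<Rightarrow> real \<Rightarrow> ennreal"
  assumes "\<And>i. f i \<in> borel_measurable borel"
  shows "(\<integral>\<^sup>+y. (\<Prod>i\<in>UNIV. f i ((y :: real ^ 'n) $ i)) \<partial>lborel)
           = (\<Prod>i\<in>UNIV. \<integral>\<^sup>+t. f i t \<partial>lborel)"
proof -
  define e :: "'n \<Rightarrow> real ^ 'n" where "e i = axis i 1" for i
  have bij: "bij_betw e UNIV Basis"
    by (auto simp: bij_betw_def inj_on_def e_def axis_eq_axis Basis_vec_def)
  have idx: "axis_index (e i) = i" for i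
    by (simp add: e_def)
  \<comment> \<open>\<open>G\<close> sees both the index and the basis vector: the factor \<open>f i\<close> depends on the
      former, its argument \<open>y \<bullet> b\<close> on the latter.\<close>
  have reindex: "(\<Prod>i\<in>UNIV. G i (e i)) = (\<Prod>b\<in>Basis. G (axis_index b) b)"
    for G :: "'n \<Rightarrow> real ^ 'n \<Rightarrow> ennreal"
    using prod.reindex_bij_betw[OF bij, of "\<lambda>b. G (axis_index b) b"] by (simp add: idx)
  have "(\<Prod>i\<in>UNIV. f i (y $ i)) = (\<Prod>b\<in>Basis. f (axis_index b) (y \<bullet> b))" for y :: "real ^ 'n"
    using reindex[of "\<lambda>i b. f i (y \<bullet> b)"] by (simp add: cart_eq_inner_axis e_def)
  then have "(\<integral>\<^sup>+y. (\<Prod>i\<in>UNIV. f i ((y :: real ^ 'n) $ i)) \<partial>lborel)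
      = (\<integral>\<^sup>+y. (\<Prod>b\<in>Basis. f (axis_index b) ((y :: real ^ 'n) \<bullet> b)) \<partial>lborel)"
    by simp
  also have "\<dots> = (\<Prod>b\<in>(Basis :: (real ^ 'n) set). \<integral>\<^sup>+t. f (axis_index b) t \<partial>lborel)"
    by (rule nn_integral_lborel_prod) (simp_all add: assms)
  also have "\<dots> = (\<Prod>i\<in>UNIV. \<integral>\<^sup>+t. f i t \<partial>lborel)"
    by (rule reindex[symmetric])
  finally show ?thesis .
qed

lemma nn_integral_exp_interval:
  fixes m s :: real
  assumes m: "m > 0" and s: "s = 1 \<or> s = -1"
  shows "(\<integral>\<^sup>+t. ennreal (exp (- ((1 - s * t) / m))) * indicator {-1..1} t \<partial>lborel)
           = ennreal (m * (1 - exp (-2 / m)))"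
proof -
  have "s * s = 1"
    using s by auto
  then have "((\<lambda>t. s * m * exp (- ((1 - s * t) / m))) has_real_derivative exp (- ((1 - s * t) / m))) (at t)" for t
    using m by (auto intro!: derivative_eq_intros)
  then have "(\<integral>\<^sup>+t. ennreal (exp (- ((1 - s * t) / m))) * indicator {-1..1} t \<partial>lborel)
      = ennreal (s * m * exp (- ((1 - s * 1) / m)) - s * m * exp (- ((1 - s * (-1)) / m)))"
    by (intro nn_integral_FTC_Icc) auto
  also have "s * m * exp (- ((1 - s * 1) / m)) - s * m * exp (- ((1 - s * (-1)) / m))
      = m * (1 - exp (-2 / m))"
    using s by (auto simp: algebra_simps)
  finally show ?thesis .
qed

abbreviation cube :: "(real ^ 'n) set" where
  "cube \<equiv> cbox (- 1) 1"

lemma mem_cube: "y \<in> cube \<longleftrightarrow> (\<forall>i. -1 \<le> y $ i \<and> y $ i \<le> 1)"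
  by (simp add: mem_box_cart)

text \<open>The factor \<open>1 - exp (-2 / m i)\<close>, which will make the volume bound strict, is the mass that an
  exponential distribution of mean \<open>m i\<close> gives to \<open>[0, 2]\<close>, the range of
  \<open>1 - s i * y $ i\<close> on the cube.\<close>

lemma set_integral_exp_cube:
  fixes m s :: "'n::finite \<Rightarrow> real"
  assumes m: "\<And>i. m i > 0" and s: "\<And>i. s i = 1 \<or> s i = -1"
  shows "(LINT y:cube|lebesgue. exp (- (\<Sum>i\<in>UNIV. (1 - s i * (y :: real ^ 'n) $ i) / m i)))
           = (\<Prod>i\<in>UNIV. m i * (1 - exp (-2 / m i)))"
proof -
  let ?h = "\<lambda>y :: real ^ 'n. - (\<Sum>i\<in>UNIV. (1 - s i * y $ i) / m i)"
  have int: "set_integrable lebesgue cube (\<lambda>y. exp (?h y))"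
    by (intro absolutely_integrable_continuous continuous_intros) (use m in \<open>simp add: less_imp_neq[symmetric]\<close>)
  have prod_form: "ennreal (indicator cube y *\<^sub>R exp (?h y))
      = (\<Prod>i\<in>UNIV. ennreal (exp (- ((1 - s i * y $ i) / m i))) * indicator {-1..1} (y $ i))" for y
  proof (cases "y \<in> cube")
    case True
    then show ?thesis
      by (simp add: mem_cube prod_ennreal exp_sum flip: sum_negf)
  next
    case False
    then obtain i where "y $ i \<notin> {-1..1}"
      by (auto simp: mem_cube)
    then have "(\<Prod>i\<in>UNIV. ennreal (exp (- ((1 - s i * y $ i) / m i))) * indicator {-1..1} (y $ i)) = 0"
      by (intro prod_zero bexI[of _ i]) (auto simp: indicator_def)
    then show ?thesis
      using False by simp
  qed
  have nonneg: "m i * (1 - exp (-2 / m i)) \<ge> 0" for i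
    using m[of i] by simp
  have "ennreal (LINT y:cube|lebesgue. exp (?h y))
      = (\<integral>\<^sup>+y. ennreal (indicator cube y *\<^sub>R exp (?h y)) \<partial>lebesgue)"
    using int unfolding set_lebesgue_integral_def set_integrable_def
    by (intro nn_integral_eq_integral[symmetric]) auto
  also have "\<dots> = (\<Prod>i\<in>UNIV. ennreal (m i * (1 - exp (-2 / m i))))"
    by (simp only: prod_form nn_integral_completion)
       (subst nn_integral_lborel_prod_cart, measurable, simp only: nn_integral_exp_interval[OF m s])
  also have "\<dots> = ennreal (\<Prod>i\<in>UNIV. m i * (1 - exp (-2 / m i)))"
    by (intro prod_ennreal nonneg)
  finally show ?thesis
  proof (subst (asm) ennreal_inj)
    show "(LINT y:cube|lebesgue. exp (?h y)) \<ge> 0"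
      unfolding set_lebesgue_integral_def by (rule Bochner_Integration.integral_nonneg) simp
    show "(\<Prod>i\<in>UNIV. m i * (1 - exp (-2 / m i))) \<ge> 0"
      by (intro prod_nonneg nonneg)
  qed
qed

section \<open>Averages over a subset of the cube\<close>

lemma set_integrable_subset_cube:
  fixes K :: "(real ^ 'n) set" and f :: "real ^ 'n \<Rightarrow> 'b::euclidean_space"
  assumes "K \<in> sets lebesgue" "K \<subseteq> cube" "continuous_on UNIV f"
  shows "set_integrable lebesgue K f"
  using assms set_integrable_subset[OF absolutely_integrable_continuous]
  by (metis continuous_on_subset subset_UNIV)

lemma set_integral_component_barycenter:
  fixes K :: "(real ^ 'n) set"
  assumes "K \<in> sets lebesgue" "K \<subseteq> cube" "measure lebesgue K > 0"
  shows "(LINT y:K|lebesgue. y $ i) = measure lebesgue K * barycenter K $ i"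
proof -
  have "integrable lebesgue (\<lambda>y. indicator K y *\<^sub>R y)"
    using set_integrable_subset_cube[OF assms(1,2), of "\<lambda>y. y"] by (simp add: set_integrable_def)
  from integral_bounded_linear[OF bounded_linear_vec_nth this]
  have "(LINT y:K|lebesgue. y $ i) = (LINT y:K|lebesgue. y) $ i"
    by (simp add: set_lebesgue_integral_def)
  then show ?thesis
    using assms(3) by (simp add: barycenter_def)
qed

lemma set_integral_affine_barycenter:
  fixes K :: "(real ^ 'n) set"
  assumes "K \<in> sets lebesgue" "K \<subseteq> cube" "measure lebesgue K > 0"
  shows "(LINT y:K|lebesgue. 1 - c * y $ i) = measure lebesgue K * (1 - c * barycenter K $ i)"
proof -
  have "set_integrable lebesgue K (\<lambda>y. 1 :: real)" "set_integrable lebesgue K (\<lambda>y. c * y $ i)"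
    by (intro set_integrable_subset_cube assms continuous_intros)+
  then have "(LINT y:K|lebesgue. 1 - c * y $ i)
      = (LINT y:K|lebesgue. 1) - c * (LINT y:K|lebesgue. y $ i)"
    by (simp add: set_integral_diff)
  also have "(LINT y:K|lebesgue. 1) = measure lebesgue K"
    by (simp add: set_lebesgue_integral_def assms)
  finally show ?thesis
    by (simp add: set_integral_component_barycenter[OF assms] algebra_simps)
qed

text \<open>If the average of \<open>1 - s * y $ i \<ge> 0\<close> over \<open>K\<close> were zero, almost all of \<open>K\<close> would lie in
  the facet \<open>y $ i = s\<close>, which is a null set.\<close>

lemma barycenter_in_open_halfspace:
  fixes K :: "(real ^ 'n) set"
  assumes K: "K \<in> sets lebesgue" "K \<subseteq> cube" "measure lebesgue K > 0" and s: "s = 1 \<or> s = -1"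
  shows "s * barycenter K $ i < 1"
proof -
  let ?g = "\<lambda>y. indicator K y *\<^sub>R (1 - s * y $ i)"
  have nonneg: "?g y \<ge> 0" for y
    using s K(2) by (auto simp: indicator_def mem_cube subset_iff)
  have int: "integrable lebesgue ?g"
    using set_integrable_subset_cube[OF K(1,2), of "\<lambda>y. 1 - s * y $ i"]
    by (simp add: set_integrable_def continuous_intros)
  have "integral\<^sup>L lebesgue ?g \<noteq> 0"
  proof
    assume "integral\<^sup>L lebesgue ?g = 0"
    then have "AE y in lebesgue. ?g y = 0"
      using integral_nonneg_eq_0_iff_AE[OF int] nonneg by simp
    moreover have "negligible {y :: real ^ 'n. y $ i = s}"
      using negligible_standard_hyperplane[of "axis i 1 :: real ^ 'n" s]
      by (simp add: cart_eq_inner_axis)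
    then have "AE y in lebesgue. y \<notin> {y :: real ^ 'n. y $ i = s}"
      by (intro AE_not_in) (simp add: negligible_iff_null_sets)
    ultimately have "AE y in lebesgue. y \<notin> K"
      by eventually_elim (use s in \<open>auto simp: indicator_def split: if_splits\<close>)
    then have "measure lebesgue K = 0"
      using K(1) by (simp add: AE_iff_null_sets measure_eq_0_null_sets)
    then show False
      using K(3) by simp
  qed
  moreover have "integral\<^sup>L lebesgue ?g \<ge> 0"
    by (rule Bochner_Integration.integral_nonneg) (rule nonneg)
  ultimately have "integral\<^sup>L lebesgue ?g > 0"
    by linarith
  then have "measure lebesgue K * (1 - s * barycenter K $ i) > 0"
    using set_integral_affine_barycenter[OF K, of s i] by (simp add: set_lebesgue_integral_def)
  then show ?thesis
    using K(3) by (simp add: zero_less_mult_iff)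
qed

text \<open>Jensen's inequality, from the tangent line of \<open>exp\<close> at the mean \<open>a\<close>.\<close>

lemma measure_mult_exp_mean_le:
  fixes K :: "'a set" and h :: "'a \<Rightarrow> real"
  assumes K: "K \<in> sets M" "emeasure M K < \<infinity>"
    and h: "set_integrable M K h" and e: "set_integrable M K (\<lambda>y. exp (h y))"
    and mean: "(LINT y:K|M. h y) = measure M K * a"
  shows "measure M K * exp a \<le> (LINT y:K|M. exp (h y))"
proof -
  have one: "set_integrable M K (\<lambda>y. c)" for c :: real
    using K by (simp add: set_integrable_def)
  have tangent: "exp a * (h y + (1 - a)) \<le> exp (h y)" for y
    using mult_left_mono[OF exp_ge_add_one_self[of "h y - a"], of "exp a"]
    by (simp add: algebra_simps flip: exp_add)
  have "(LINT y:K|M. h y + (1 - a)) = measure M K * a + measure M K * (1 - a)"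
    using K by (simp add: set_integral_add(2)[OF h one] mean) (simp add: set_lebesgue_integral_def)
  also have "\<dots> = measure M K"
    by (simp add: algebra_simps)
  finally have "measure M K * exp a = (LINT y:K|M. exp a * (h y + (1 - a)))"
    by simp
  also have "\<dots> \<le> (LINT y:K|M. exp (h y))"
    by (intro set_integral_mono tangent e set_integrable_mult_right set_integral_add(1) h one)
  finally show ?thesis .
qed

section \<open>The volume bound\<close>

theorem proposition4p2:
  fixes K :: "(real ^ 'n) set" and x :: "real ^ 'n"
  assumes "K \<in> sets lebesgue"
    and "K \<subseteq> {y. \<forall>i. y $ i \<in> {-1..1}}"
    and "measure lebesgue K > 0"
    and "barycenter K = x"
  shows "measure lebesgue K < exp 1 ^ CARD('n) * (\<Prod>i\<in>UNIV. 1 - \<bar>x $ i\<bar>)"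
proof -
  let ?n = "real CARD('n)"
  have "K \<subseteq> cube"
    using assms(2) by (auto simp: mem_cube)
  note K = assms(1) this assms(3)
  \<comment> \<open>Not \<open>sgn (x $ i)\<close>: where \<open>x $ i = 0\<close>, a sign is still needed, either one will do.\<close>
  define s :: "'n \<Rightarrow> real" where "s i = (if x $ i \<ge> 0 then 1 else -1)" for i
  define m :: "'n \<Rightarrow> real" where "m i = 1 - \<bar>x $ i\<bar>" for i
  define h :: "real ^ 'n \<Rightarrow> real" where "h y = - (\<Sum>i\<in>UNIV. (1 - s i * y $ i) / m i)" for y
  have s: "s i = 1 \<or> s i = -1" and m_eq: "m i = 1 - s i * x $ i" for i
    by (auto simp: s_def m_def)
  have m: "m i > 0" for i
    using barycenter_in_open_halfspace[OF K s, of i i] by (simp add: assms(4) m_eq)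
  then have m0: "m i \<noteq> 0" for i
    by (metis less_irrefl)
  have cont: "continuous_on UNIV h"
    unfolding h_def by (intro continuous_intros) (simp add: m0)
  have cont_exp: "continuous_on UNIV (\<lambda>y. exp (h y))"
    by (intro continuous_intros cont)
  have mean: "(LINT y:K|lebesgue. h y) = measure lebesgue K * (- ?n)"
  proof -
    have term_int: "set_integrable lebesgue K (\<lambda>y. (1 - s i * y $ i) / m i)" for i
      by (intro set_integrable_subset_cube K(1,2) continuous_intros) (simp add: m0)
    have term_eq: "(LINT y:K|lebesgue. (1 - s i * y $ i) / m i) = measure lebesgue K" for i
      using set_integral_affine_barycenter[OF K, of "s i" i] m0[of i]
      by (simp add: assms(4) flip: m_eq)
    have "(LINT y:K|lebesgue. h y)
        = - (\<Sum>i\<in>UNIV. LINT y:K|lebesgue. (1 - s i * y $ i) / m i)"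
      using term_int unfolding h_def set_lebesgue_integral_def set_integrable_def
      by (simp only: scaleR_minus_right scaleR_sum_right Bochner_Integration.integral_minus Bochner_Integration.integral_sum)
    then show ?thesis
      by (simp only: term_eq) simp
  qed
  have "emeasure lebesgue K < \<infinity>"
    using K(3) by (simp add: measure_def enn2real_positive_iff)
  then have "measure lebesgue K * exp (- ?n) \<le> (LINT y:K|lebesgue. exp (h y))"
    by (intro measure_mult_exp_mean_le mean set_integrable_subset_cube K cont cont_exp)
  also have "\<dots> \<le> (LINT y:cube|lebesgue. exp (h y))"
    using set_integrable_subset_cube[OF K(1,2) cont_exp] set_integrable_subset_cube[OF _ order_refl cont_exp] K(2)
    unfolding set_lebesgue_integral_def set_integrable_def
    by (intro integral_mono) (auto simp: indicator_def)
  also have "\<dots> = (\<Prod>i\<in>UNIV. m i * (1 - exp (-2 / m i)))"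
    unfolding h_def by (rule set_integral_exp_cube[OF m s])
  \<comment> \<open>Every factor decreases strictly, so any index is a witness.\<close>
  also have "\<dots> < (\<Prod>i\<in>UNIV. m i)"
    using m by (intro prod_mono_strict[of undefined])
      (auto simp: mult_less_cancel_left1 mult_le_cancel_left1 less_imp_le)
  finally have "measure lebesgue K * exp (- ?n) < (\<Prod>i\<in>UNIV. m i)" .
  then have "measure lebesgue K < exp ?n * (\<Prod>i\<in>UNIV. m i)"
    by (simp add: exp_minus field_simps)
  also have "exp ?n = exp 1 ^ CARD('n)"
    using exp_of_nat_mult[of "CARD('n)" "1 :: real"] by simp
  finally show ?thesis
    by (simp add: m_def)
qed

end
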